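(* The least order of a noncommutative even square ring of odd order is nine. That is, there exists a noncommutative even square ring of order $9$, and there is no noncommutative even square ring whose order is finite, odd and less than $9$.
   Context: Rings are associative and are not assumed to have a multiplicative identity. A ring $R$ is called an even square ring if $a^2 \in 2R$ for all $a \in R$, where $2R = \{2r : r \in R\}$ and $2r = r + r$. The order of a finite ring is its number of elements. *)

theory Defs
  imports "HOL-Algebra.Ring" "HOL-Algebra.Coset"
begin

(* Associative rings, not assumed to have a multiplicative identity.  They share the record type
   of HOL-Algebra rings; the field "one" is unconstrained and is never referred to. *)
locale rng = abelian_group R for R (structure) +
  assumes m_closed: "\<lbrakk>x \<in> carrier R; y \<in> carrier R\<rbrakk> \<Longrightarrow> x \<otimes> y \<in> carrier R"
    and m_assoc: "\<lbrakk>x \<in> carrier R; y \<in> carrier R; z \<in> carrier R\<rbrakk>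
      \<Longrightarrow> (x \<otimes> y) \<otimes> z = x \<otimes> (y \<otimes> z)"
    and l_distr: "\<lbrakk>x \<in> carrier R; y \<in> carrier R; z \<in> carrier R\<rbrakk>
      \<Longrightarrow> (x \<oplus> y) \<otimes> z = x \<otimes> z \<oplus> y \<otimes> z"
    and r_distr: "\<lbrakk>x \<in> carrier R; y \<in> carrier R; z \<in> carrier R\<rbrakk>
      \<Longrightarrow> z \<otimes> (x \<oplus> y) = z \<otimes> x \<oplus> z \<otimes> y"

lemma (in ring) ring_is_rng: "rng R"
  by unfold_locales (simp_all add: m_assoc l_distr r_distr)

definition doubles :: "('a, 'm) ring_scheme \<Rightarrow> 'a set" where
  "doubles R = {r \<oplus>\<^bsub>R\<^esub> r | r. r \<in> carrier R}"

locale even_square_ring = rng +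
  assumes square_in_doubles: "a \<in> carrier R \<Longrightarrow> a \<otimes> a \<in> doubles R"

definition noncommutative :: "('a, 'm) ring_scheme \<Rightarrow> bool" where
  "noncommutative R \<longleftrightarrow> (\<exists>a \<in> carrier R. \<exists>b \<in> carrier R. a \<otimes>\<^bsub>R\<^esub> b \<noteq> b \<otimes>\<^bsub>R\<^esub> a)"

end

theory Submission
  imports Defs
begin

text \<open>
  The lower bound comes from Lagrange's theorem. If \<open>a\<close> does not commute with \<open>b\<close>, then the
  centralizer of \<open>a\<close> is an additive subgroup that contains 0 and \<open>a \<noteq> 0\<close> but misses \<open>b\<close>; its
  order is therefore a divisor of the order of the ring lying strictly between 1 and that order
  (lemma \<open>noncommutative_imp_proper_divisor\<close>). None of 1, 3, 5, 7 has such a divisor.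

  For order 9, a linear functional \<open>f\<close> on a vector space makes \<open>x y = f(x) y\<close> an associative
  product, because \<open>f(f(x) y) = f(x) f(y)\<close>. It is noncommutative as soon as there are \<open>x\<close> with
  \<open>f(x) = 1\<close> and \<open>y \<noteq> 0\<close> with \<open>f(y) = 0\<close>: then \<open>x y = y\<close> and \<open>y x = 0\<close>. The plane over the field
  with three elements has room for this, and there every element is a double, in particular every
  square.
\<close>

lemma (in rng) zero_mult:
  assumes "a \<in> carrier R"
  shows "\<zero> \<otimes> a = \<zero>" "a \<otimes> \<zero> = \<zero>"
proof -
  have "\<zero> \<otimes> a \<oplus> \<zero> \<otimes> a = \<zero> \<otimes> a"
    using assms l_distr[of \<zero> \<zero> a] by simp
  then show "\<zero> \<otimes> a = \<zero>"
    using assms by (simp add: m_closed)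
  have "a \<otimes> \<zero> \<oplus> a \<otimes> \<zero> = a \<otimes> \<zero>"
    using assms r_distr[of \<zero> \<zero> a] by simp
  then show "a \<otimes> \<zero> = \<zero>"
    using assms by (simp add: m_closed)
qed

text \<open>
  Centralizers are additive subgroups by distributivity; closure under negation comes from
  \<open>a (-x) + a x = 0 = (-x) a + x a\<close> by cancellation.
\<close>

lemma (in rng) centralizer_subgroup:
  assumes a: "a \<in> carrier R"
  shows "subgroup {x \<in> carrier R. a \<otimes> x = x \<otimes> a} (add_monoid R)"
proof (rule add.subgroupI)
  show "{x \<in> carrier R. a \<otimes> x = x \<otimes> a} \<noteq> {}"
    using a by blast
next
  fix x assume x: "x \<in> {x \<in> carrier R. a \<otimes> x = x \<otimes> a}"
  then have xc: "x \<in> carrier R" and comm: "a \<otimes> x = x \<otimes> a"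
    by auto
  have "a \<otimes> (\<ominus> x) \<oplus> a \<otimes> x = \<zero>"
    using a xc r_distr[of "\<ominus> x" x a] by (simp add: l_neg zero_mult)
  moreover have "(\<ominus> x) \<otimes> a \<oplus> a \<otimes> x = \<zero>"
    using a xc l_distr[of "\<ominus> x" x a] by (simp add: l_neg zero_mult comm)
  ultimately have "a \<otimes> (\<ominus> x) = (\<ominus> x) \<otimes> a"
    using a xc by (metis add.right_cancel m_closed a_inv_closed)
  then show "\<ominus> x \<in> {x \<in> carrier R. a \<otimes> x = x \<otimes> a}"
    using xc by simp
qed (use a in \<open>auto simp: l_distr r_distr\<close>)

lemma (in rng) noncommutative_imp_proper_divisor:
  assumes fin: "finite (carrier R)" and nc: "noncommutative R"
  obtains d where "d dvd order R" "1 < d" "d < order R"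
proof -
  from nc obtain a b where a: "a \<in> carrier R" and b: "b \<in> carrier R" and ab: "a \<otimes> b \<noteq> b \<otimes> a"
    unfolding noncommutative_def by blast
  let ?C = "{x \<in> carrier R. a \<otimes> x = x \<otimes> a}"
  have "card ?C dvd order R"
  proof (rule dvdI)
    show "order R = card ?C * card (rcosets\<^bsub>add_monoid R\<^esub> ?C)"
      using add.lagrange[OF centralizer_subgroup[OF a]] by (simp add: order_def mult.commute)
  qed
  moreover have "1 < card ?C"
  proof -
    have "a \<noteq> \<zero>"
      using ab b by (auto simp: zero_mult)
    then have "card {\<zero>, a} = 2"
      by auto
    moreover have "card {\<zero>, a} \<le> card ?C"
      using fin a by (intro card_mono) (auto simp: zero_mult)
    ultimately show ?thesis
      by simp
  qed
  moreover have "card ?C < order R"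
    unfolding order_def using fin b ab by (intro psubset_card_mono) auto
  ultimately show thesis
    by (rule that)
qed

text \<open>
  The pair \<open>(a, b)\<close> of residues modulo 3 is coded as \<open>a + 3 b\<close>, so that \<open>x mod 3\<close> and \<open>x div 3\<close>
  are the coordinates of a number \<open>x < 9\<close>.
\<close>

definition residue_pair :: "nat \<Rightarrow> nat \<Rightarrow> nat" where
  "residue_pair a b = a mod 3 + 3 * (b mod 3)"

lemma residue_pair_mod [simp]: "residue_pair a b mod 3 = a mod 3"
  by (simp add: residue_pair_def)

lemma residue_pair_div [simp]: "residue_pair a b div 3 = b mod 3"
  by (simp add: residue_pair_def)

lemma residue_pair_cong:
  "a mod 3 = c mod 3 \<Longrightarrow> b mod 3 = d mod 3 \<Longrightarrow> residue_pair a b = residue_pair c d"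
  by (simp add: residue_pair_def)

lemma residue_pair_less: "residue_pair a b < 9"
proof -
  have "a mod 3 < 3" "b mod 3 < 3"
    by simp_all
  then show ?thesis
    unfolding residue_pair_def by linarith
qed

lemma residue_pair_coordinates:
  assumes "x < 9" shows "residue_pair (x mod 3) (x div 3) = x"
proof -
  have "x div 3 < 3"
    using assms by (simp add: less_mult_imp_div_less)
  then show ?thesis
    by (simp add: residue_pair_def)
qed

text \<open>
  The product multiplies the vector \<open>y\<close> by the first coordinate of \<open>x\<close>: the linear functional
  is the first coordinate. The field \<open>one\<close> is a dummy, since there is no identity.
\<close>

definition scaling_ring :: "nat ring" where
  "scaling_ring =
     \<lparr>carrier = {..<9},
      mult = (\<lambda>x y. residue_pair (x mod 3 * (y mod 3)) (x mod 3 * (y div 3))),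
      one = 0,
      zero = 0,
      add = (\<lambda>x y. residue_pair (x mod 3 + y mod 3) (x div 3 + y div 3))\<rparr>"

text \<open>
  The next facts let coordinates be arbitrary representatives of their residue classes, so that the
  laws of the ring become identities between natural numbers.
\<close>

lemma residue_pair_carrier [simp]: "residue_pair a b \<in> carrier scaling_ring"
  by (simp add: scaling_ring_def residue_pair_less)

lemma scaling_ring_elementE:
  assumes "x \<in> carrier scaling_ring"
  obtains a b where "x = residue_pair a b"
proof -
  have "x < 9"
    using assms by (simp add: scaling_ring_def)
  then show thesis
    using residue_pair_coordinates by (intro that[of "x mod 3" "x div 3"]) simp
qed

lemma scaling_ring_add:
  "residue_pair a b \<oplus>\<^bsub>scaling_ring\<^esub> residue_pair c d = residue_pair (a + c) (b + d)"
  by (auto simp: scaling_ring_def mod_simps intro!: residue_pair_cong)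

lemma scaling_ring_mult:
  "residue_pair a b \<otimes>\<^bsub>scaling_ring\<^esub> residue_pair c d = residue_pair (a * c) (a * d)"
  by (auto simp: scaling_ring_def mod_simps intro!: residue_pair_cong)

lemma scaling_ring_zero: "\<zero>\<^bsub>scaling_ring\<^esub> = residue_pair 0 0"
  by (simp add: scaling_ring_def residue_pair_def)

lemma abelian_group_scaling_ring: "abelian_group scaling_ring"
proof (rule abelian_groupI)
  fix x assume "x \<in> carrier scaling_ring"
  then obtain a b where x: "x = residue_pair a b"
    by (rule scaling_ring_elementE)
  \<comment> \<open>Doubling a coordinate negates it modulo 3.\<close>
  have "residue_pair (2 * a) (2 * b) \<oplus>\<^bsub>scaling_ring\<^esub> x = residue_pair (3 * a) (3 * b)"
    by (simp add: x scaling_ring_add)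
  also have "\<dots> = \<zero>\<^bsub>scaling_ring\<^esub>"
    by (simp add: scaling_ring_zero residue_pair_def)
  finally show "\<exists>y\<in>carrier scaling_ring. y \<oplus>\<^bsub>scaling_ring\<^esub> x = \<zero>\<^bsub>scaling_ring\<^esub>"
    by (rule bexI) simp
qed (auto simp: scaling_ring_add scaling_ring_zero add_ac elim!: scaling_ring_elementE)

lemma rng_scaling_ring: "rng scaling_ring"
  by (intro rng.intro rng_axioms.intro abelian_group_scaling_ring)
    (auto simp: scaling_ring_add scaling_ring_mult algebra_simps elim!: scaling_ring_elementE)

text \<open>In characteristic 3 every element is a double: \<open>x = 4 x = 2 x + 2 x\<close>.\<close>

lemma doubles_scaling_ring:
  assumes "x \<in> carrier scaling_ring"
  shows "x \<in> doubles scaling_ring"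
proof -
  from assms obtain a b where x: "x = residue_pair a b"
    by (rule scaling_ring_elementE)
  let ?r = "residue_pair (2 * a) (2 * b)"
  have "?r \<oplus>\<^bsub>scaling_ring\<^esub> ?r = residue_pair (4 * a) (4 * b)"
    by (simp add: scaling_ring_add)
  also have "\<dots> = x"
  proof -
    have "4 * n mod 3 = n mod 3" for n :: nat
      by presburger
    then show ?thesis
      by (simp add: x residue_pair_def)
  qed
  finally have "x = ?r \<oplus>\<^bsub>scaling_ring\<^esub> ?r" ..
  moreover have "?r \<in> carrier scaling_ring"
    by simp
  ultimately show ?thesis
    unfolding doubles_def by blast
qed

lemma even_square_scaling_ring: "even_square_ring scaling_ring"
  by (intro even_square_ring.intro even_square_ring_axioms.intro rng_scaling_ring
      doubles_scaling_ring rng.m_closed)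

lemma noncommutative_scaling_ring: "noncommutative scaling_ring"
  unfolding noncommutative_def
proof (intro bexI)
  \<comment> \<open>The numbers 1 and 3 code the basis vectors \<open>(1, 0)\<close> and \<open>(0, 1)\<close>.\<close>
  show "1 \<otimes>\<^bsub>scaling_ring\<^esub> 3 \<noteq> 3 \<otimes>\<^bsub>scaling_ring\<^esub> 1"
    by (simp add: scaling_ring_def residue_pair_def)
qed (simp_all add: scaling_ring_def)

theorem proposition4:
  shows "(\<exists>R :: nat ring. even_square_ring R \<and> noncommutative R \<and> order R = 9) \<and>
         \<not> (\<exists>R :: 'a ring. even_square_ring R \<and> noncommutative R \<and>
              finite (carrier R) \<and> odd (order R) \<and> order R < 9)"
proof (intro conjI notI)
  have "order scaling_ring = 9"
    by (simp add: order_def scaling_ring_def)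
  then show "\<exists>R :: nat ring. even_square_ring R \<and> noncommutative R \<and> order R = 9"
    using even_square_scaling_ring noncommutative_scaling_ring by blast
next
  assume "\<exists>R :: 'a ring. even_square_ring R \<and> noncommutative R \<and>
              finite (carrier R) \<and> odd (order R) \<and> order R < 9"
  then obtain R :: "'a ring" where "even_square_ring R" and nc: "noncommutative R"
    and fin: "finite (carrier R)" and odd: "odd (order R)" and less: "order R < 9"
    by blast
  then have "rng R"
    by (simp add: even_square_ring_def)
  then obtain d where d: "d dvd order R" "1 < d" "d < order R"
    using rng.noncommutative_imp_proper_divisor fin nc by blast
  then obtain k where k: "order R = d * k"
    by blast
  \<comment> \<open>Both factors are odd and exceed 1, so they are at least 3 and their product is at least 9.\<close>
  have "odd d" "odd k"
    using odd k by auto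
  moreover have "k \<noteq> 1"
    using d k by auto
  ultimately have "3 \<le> d" "3 \<le> k"
    using d(2) by presburger+
  then have "3 * 3 \<le> d * k"
    by (rule mult_le_mono)
  then show False
    using less k by simp
qed

end
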